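(* Let $X$ be a Tychonoff space and let $A$ be a closed and Čech-complete subset of $X$. Then the following conditions are equivalent. (1) $A$ is Lindelöf and $C$-embedded in $X$. (2) There is a countable family $\mathcal{Z}$ of zero-sets of $\beta X$ such that $\mathrm{cl}_{\beta X}A\setminus A\subseteq\bigcup\mathcal{Z}\subseteq\beta X\setminus X$.
   Context: $\beta X$ denotes the Čech–Stone compactification of the Tychonoff space $X$, with $X$ regarded as a subspace of $\beta X$, and $\mathrm{cl}_{\beta X}A$ is the closure of $A$ in $\beta X$. A subspace $A$ of $X$ is $C$-embedded in $X$ if every continuous function from $A$ to $\mathbb{R}$ admits a continuous extension to $X$. A zero-set of a space $Y$ is a set of the form $\{y\in Y: g(y)=0\}$ for some continuous $g:Y\to\mathbb{R}$. A Tychonoff space is Čech-complete if it is a $G_\delta$-subset of (some, equivalently every) Hausdorff compactification of it; equivalently, its remainder in such a compactification is an $F_\sigma$-set. *)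

theory Defs
  imports "HOL-Analysis.Analysis"
begin

section \<open>Zero-sets, C-embedded subspaces\<close>

definition zero_set_in :: "'a topology \<Rightarrow> 'a set \<Rightarrow> bool" where
  "zero_set_in Y Z \<longleftrightarrow>
     (\<exists>g. continuous_map Y euclideanreal g \<and> Z = {y \<in> topspace Y. g y = 0})"

definition C_embedded_in :: "'a topology \<Rightarrow> 'a set \<Rightarrow> bool" where
  "C_embedded_in X A \<longleftrightarrow> A \<subseteq> topspace X \<and>
     (\<forall>f. continuous_map (subtopology X A) euclideanreal f \<longrightarrow>
          (\<exists>g. continuous_map X euclideanreal g \<and> (\<forall>x\<in>A. g x = f x)))"

section \<open>Hausdorff compactifications\<close>

definition Hausdorff_compactification ::
    "'a topology \<Rightarrow> 'b topology \<Rightarrow> ('a \<Rightarrow> 'b) \<Rightarrow> bool" where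
  "Hausdorff_compactification X K e \<longleftrightarrow>
     compact_space K \<and> Hausdorff_space K \<and> embedding_map X K e \<and>
     K closure_of (e ` topspace X) = topspace K"

section \<open>The Stone-Cech compactification\<close>

text \<open>The Tychonoff space \<open>X\<close> is embedded by evaluation in the cube with one factor \<open>[0,1]\<close>
  for every continuous map \<open>X \<rightarrow> [0,1]\<close>; the compactification is the closure of the image.
  The points of \<open>X\<close> are therefore represented in it by their images under
  \<open>Stone_Cech_embedding X\<close>.  Maps are taken extensional on \<open>topspace X\<close>, so that each of
  them is counted once.\<close>

definition unit_maps :: "'a topology \<Rightarrow> ('a \<Rightarrow> real) set" where
  "unit_maps X = {f \<in> extensional (topspace X). continuous_map X (top_of_set {0..1}) f}"

definition Stone_Cech_embedding :: "'a topology \<Rightarrow> 'a \<Rightarrow> ('a \<Rightarrow> real) \<Rightarrow> real" where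
  "Stone_Cech_embedding X x = (\<lambda>f\<in>unit_maps X. f x)"

definition Stone_Cech :: "'a topology \<Rightarrow> (('a \<Rightarrow> real) \<Rightarrow> real) topology" where
  "Stone_Cech X =
     (let cube = product_topology (\<lambda>f. top_of_set {0..1::real}) (unit_maps X)
      in subtopology cube (cube closure_of (Stone_Cech_embedding X ` topspace X)))"

section \<open>Cech-complete spaces\<close>

text \<open>Every Hausdorff compactification of \<open>X\<close> is a quotient of \<open>Stone_Cech X\<close>, so up to
  homeomorphism all of them live on the type over which the existential quantifier ranges.
  Lemma \<open>Cech_complete_space_iff\<close> below shows that the choice of the compactification, and
  of the type of its points, is immaterial.\<close>

definition Cech_complete_space :: "'a topology \<Rightarrow> bool" where
  "Cech_complete_space X \<longleftrightarrow>
     (\<exists>(K :: (('a \<Rightarrow> real) \<Rightarrow> real) topology) e.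
        Hausdorff_compactification X K e \<and> gdelta_in K (e ` topspace X))"

section \<open>Basic properties\<close>

lemma embedding_imp_continuous_map: "embedding_map X Y f \<Longrightarrow> continuous_map X Y f"
  unfolding embedding_map_def
  by (auto dest!: homeomorphic_imp_continuous_map simp: continuous_map_in_subtopology)

lemma unit_maps_eq:
  "unit_maps X = mspace (submetric (cfunspace X euclidean_metric) {f. f \<in> topspace X \<rightarrow> {0..1}})"
  unfolding unit_maps_def
  by (auto simp: continuous_map_in_subtopology image_subset_iff Pi_iff
      intro: bounded_subset[OF bounded_closed_interval[of 0 "1::real"]])

lemma embedding_map_cube:
  assumes "completely_regular_space X" "Hausdorff_space X"
  shows "embedding_map X (product_topology (\<lambda>f. top_of_set {0..1::real}) (unit_maps X))
           (Stone_Cech_embedding X)"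
  using completely_regular_space_cube_embedding_explicit[OF assms]
  unfolding unit_maps_eq Stone_Cech_embedding_def[abs_def] .

lemma Hausdorff_compactification_Stone_Cech:
  assumes "completely_regular_space X" "Hausdorff_space X"
  shows "Hausdorff_compactification X (Stone_Cech X) (Stone_Cech_embedding X)"
proof -
  define P where "P = product_topology (\<lambda>f. top_of_set {0..1::real}) (unit_maps X)"
  define e where "e = Stone_Cech_embedding X"
  define C where "C = P closure_of (e ` topspace X)"
  have S: "Stone_Cech X = subtopology P C"
    by (simp add: Stone_Cech_def P_def C_def e_def Let_def)
  have emb: "embedding_map X P e"
    using embedding_map_cube[OF assms] by (simp add: P_def e_def)
  have im: "e ` topspace X \<subseteq> topspace P"
    using emb continuous_map_image_subset_topspace embedding_imp_continuous_map by blast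
  have CP: "compact_space P"
    by (simp add: P_def compact_space_product_topology compact_space_subtopology)
  have HP: "Hausdorff_space P"
    by (simp add: P_def Hausdorff_space_product_topology Hausdorff_space_subtopology)
  have sub: "e ` topspace X \<subseteq> C"
    unfolding C_def by (rule closure_of_subset[OF im])
  have "compact_space (subtopology P C)"
    using CP unfolding C_def
    by (intro compact_space_subtopology closedin_compact_space) auto
  moreover have "Hausdorff_space (subtopology P C)"
    using HP by (rule Hausdorff_space_subtopology)
  moreover have "embedding_map X (subtopology P C) e"
    using emb sub by (simp add: embedding_map_in_subtopology image_subset_iff_funcset)
  moreover have "subtopology P C closure_of (e ` topspace X) = topspace (subtopology P C)"
    using sub closure_of_subset_topspace[of P "e ` topspace X"]
    by (simp add: closure_of_subtopology Int_absorb1 C_def[symmetric] inf.absorb2)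
  ultimately show ?thesis
    by (simp add: Hausdorff_compactification_def S e_def)
qed

lemma Stone_Cech_extension:
  fixes K :: "'b topology"
  assumes X: "completely_regular_space X" "Hausdorff_space X"
    and K: "compact_space K" "Hausdorff_space K" and h: "continuous_map X K h"
  obtains H where "continuous_map (Stone_Cech X) K H"
    and "\<And>x. x \<in> topspace X \<Longrightarrow> H (Stone_Cech_embedding X x) = h x"
proof -
  define P where "P = product_topology (\<lambda>f. top_of_set {0..1::real}) (unit_maps X)"
  define Q where "Q = product_topology (\<lambda>f. top_of_set {0..1::real}) (unit_maps K)"
  define e where "e = Stone_Cech_embedding X"
  define d where "d = Stone_Cech_embedding K"
  define E where "E = e ` topspace X"
  define D where "D = d ` topspace K"
  have S: "Stone_Cech X = subtopology P (P closure_of E)"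
    by (simp add: Stone_Cech_def P_def E_def e_def Let_def)
  have crK: "completely_regular_space K"
    using K compact_Hausdorff_imp_regular_space compact_Hausdorff_or_regular_imp_normal_space
      normal_imp_completely_regular_space_A Hausdorff_imp_t1_space
      normal_imp_completely_regular_space by blast
  have embK: "embedding_map K Q d"
    using embedding_map_cube[OF crK K(2)] by (simp add: Q_def d_def)
  have HQ: "Hausdorff_space Q"
    by (simp add: Q_def Hausdorff_space_product_topology Hausdorff_space_subtopology)
  have "compactin Q D"
    unfolding D_def using K(1) embK compact_space_def embedding_imp_continuous_map image_compactin by blast
  then have clD: "closedin Q D"
    using HQ compactin_imp_closedin by blast
  from embK obtain r where r: "continuous_map (subtopology Q D) K r"
    and rd: "\<And>y. y \<in> topspace K \<Longrightarrow> r (d y) = y"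
    unfolding embedding_map_def D_def homeomorphic_map_maps homeomorphic_maps_def by blast
  define G :: "(('a \<Rightarrow> real) \<Rightarrow> real) \<Rightarrow> ('b \<Rightarrow> real) \<Rightarrow> real"
    where "G = (\<lambda>p. \<lambda>g\<in>unit_maps K. p (restrict (g \<circ> h) (topspace X)))"
  have um: "restrict (g \<circ> h) (topspace X) \<in> unit_maps X" if "g \<in> unit_maps K" for g
  proof -
    have "continuous_map X (top_of_set {0..1}) (g \<circ> h)"
      using that h continuous_map_compose by (auto simp: unit_maps_def)
    then show ?thesis
      by (simp add: unit_maps_def)
  qed
  have G: "continuous_map P Q G"
    unfolding Q_def continuous_map_componentwise
  proof (intro conjI ballI)
    show "G ` topspace P \<subseteq> extensional (unit_maps K)" by (auto simp: G_def)
    fix g assume g: "g \<in> unit_maps K"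
    have "continuous_map P (top_of_set {0..1}) (\<lambda>p. p (restrict (g \<circ> h) (topspace X)))"
      unfolding P_def by (rule continuous_map_product_projection[OF um[OF g]])
    then show "continuous_map P (top_of_set {0..1}) (\<lambda>x. G x g)"
      using g by (simp add: G_def)
  qed
  have Ge: "G (e x) = d (h x)" if "x \<in> topspace X" for x
    using that um by (auto simp: G_def e_def d_def Stone_Cech_embedding_def fun_eq_iff)
  have hx: "h x \<in> topspace K" if "x \<in> topspace X" for x
    using that h continuous_map_image_subset_topspace by blast
  have "G ` E \<subseteq> D"
    using Ge hx by (auto simp: E_def D_def)
  then have "G ` (P closure_of E) \<subseteq> D"
    using continuous_map_image_closure_subset[OF G, of E] closure_of_minimal[OF _ clD, of "G ` E"]
    by blast
  then have "continuous_map (Stone_Cech X) (subtopology Q D) G"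
    unfolding S using G
    by (auto simp: continuous_map_in_subtopology continuous_map_from_subtopology image_subset_iff)
  then have "continuous_map (Stone_Cech X) K (r \<circ> G)"
    using r continuous_map_compose by blast
  moreover have "(r \<circ> G) (Stone_Cech_embedding X x) = h x" if "x \<in> topspace X" for x
    using Ge[OF that] rd[OF hx[OF that]] by (simp add: e_def)
  ultimately show thesis using that by blast
qed

lemma Hausdorff_compactification_imp_Tychonoff:
  assumes "Hausdorff_compactification X K e"
  shows "completely_regular_space X" "Hausdorff_space X"
proof -
  have K: "compact_space K" "Hausdorff_space K" and
    hom: "X homeomorphic_space (subtopology K (e ` topspace X))"
    using assms unfolding Hausdorff_compactification_def embedding_map_def homeomorphic_space
    by blast+
  have "completely_regular_space K"
    using K compact_Hausdorff_or_regular_imp_normal_space Hausdorff_imp_t1_space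
      normal_imp_completely_regular_space by blast
  then show "completely_regular_space X"
    using hom homeomorphic_completely_regular_space completely_regular_space_subtopology by blast
  show "Hausdorff_space X"
    using hom K(2) homeomorphic_Hausdorff_space Hausdorff_space_subtopology by blast
qed

text \<open>A map of compactifications sends the remainder onto the remainder.\<close>

lemma remainder_image:
  assumes B: "Hausdorff_compactification X B b" and K: "Hausdorff_compactification X K e"
    and H: "continuous_map B K H" and He: "\<And>x. x \<in> topspace X \<Longrightarrow> H (b x) = e x"
  shows "H ` topspace B = topspace K"
    and "p \<in> topspace B \<Longrightarrow> H p \<in> e ` topspace X \<longleftrightarrow> p \<in> b ` topspace X"
proof -
  have cB: "compact_space B" and hB: "Hausdorff_space B" and bemb: "embedding_map X B b"
    and bd: "B closure_of (b ` topspace X) = topspace B"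
    and cK: "compact_space K" and hK: "Hausdorff_space K" and eemb: "embedding_map X K e"
    and ed: "K closure_of (e ` topspace X) = topspace K"
    using B K by (auto simp: Hausdorff_compactification_def)
  have Hb: "H ` b ` topspace X = e ` topspace X"
    using He by (auto simp: image_iff)
  have bsub: "b ` topspace X \<subseteq> topspace B"
    using bemb continuous_map_image_subset_topspace embedding_imp_continuous_map by blast
  have "closed_map B K H"
    using cB hK H continuous_imp_closed_map by blast
  then have "closedin K (H ` topspace B)"
    by (simp add: closed_map_def)
  moreover have "e ` topspace X \<subseteq> H ` topspace B"
    using Hb bsub by blast
  ultimately have "topspace K \<subseteq> H ` topspace B"
    using closure_of_minimal ed by metis
  then show "H ` topspace B = topspace K"
    using H continuous_map_image_subset_topspace by blast
  show "H p \<in> e ` topspace X \<longleftrightarrow> p \<in> b ` topspace X" if p: "p \<in> topspace B"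
  proof
    assume "p \<in> b ` topspace X"
    then show "H p \<in> e ` topspace X" using He by auto
  next
    assume "H p \<in> e ` topspace X"
    then obtain x where x: "x \<in> topspace X" "H p = e x" by blast
    from eemb obtain r where r: "continuous_map (subtopology K (e ` topspace X)) X r"
      and re: "\<And>y. y \<in> topspace X \<Longrightarrow> r (e y) = y"
      unfolding embedding_map_def homeomorphic_map_maps homeomorphic_maps_def by blast
    define S where "S = {q \<in> topspace B. H q \<in> e ` topspace X}"
    have bS: "b ` topspace X \<subseteq> S" using bsub He by (auto simp: S_def)
    have HS: "continuous_map (subtopology B S) (subtopology K (e ` topspace X)) H"
      using H by (auto simp: continuous_map_in_subtopology continuous_map_from_subtopology S_def)
    have "continuous_map (subtopology B S) B (b \<circ> (r \<circ> H))"
      by (rule continuous_map_compose[OF continuous_map_compose[OF HS r]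
            embedding_imp_continuous_map[OF bemb]])
    moreover have "continuous_map (subtopology B S) B (\<lambda>q. q)"
      by (simp add: continuous_map_from_subtopology)
    moreover have "p \<in> subtopology B S closure_of (b ` topspace X)"
      using p x bS bd by (auto simp: closure_of_subtopology Int_absorb1 inf.absorb2 S_def)
    moreover have "(b \<circ> (r \<circ> H)) q = q" if "q \<in> b ` topspace X" for q
      using that He re by auto
    ultimately have "(b \<circ> (r \<circ> H)) p = p"
      using forall_in_closure_of_eq[OF _ hB, where f="b \<circ> (r \<circ> H)" and g="\<lambda>q. q"] by blast
    then have "p = b x"
      using x re by simp
    then show "p \<in> b ` topspace X"
      using x by blast
  qed
qed

lemma gdelta_in_Stone_Cech_iff:
  assumes K: "Hausdorff_compactification X K e"
  shows "gdelta_in K (e ` topspace X) \<longleftrightarrow>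
         gdelta_in (Stone_Cech X) (Stone_Cech_embedding X ` topspace X)"
proof -
  note X = Hausdorff_compactification_imp_Tychonoff[OF K]
  define B where "B = Stone_Cech X"
  define b where "b = Stone_Cech_embedding X"
  have B: "Hausdorff_compactification X B b"
    using Hausdorff_compactification_Stone_Cech[OF X] by (simp add: B_def b_def)
  have cK: "compact_space K" and hK: "Hausdorff_space K" and ce: "continuous_map X K e"
    and cB: "compact_space B" and cb: "continuous_map X B b"
    using K B by (auto simp: Hausdorff_compactification_def embedding_imp_continuous_map)
  obtain H where H: "continuous_map B K H" and He: "\<And>x. x \<in> topspace X \<Longrightarrow> H (b x) = e x"
    using Stone_Cech_extension[OF X cK hK ce] unfolding B_def b_def by blast
  have rem: "H ` topspace B = topspace K"
    "\<And>p. p \<in> topspace B \<Longrightarrow> H p \<in> e ` topspace X \<longleftrightarrow> p \<in> b ` topspace X"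
    using remainder_image[OF B K H] He by blast+
  have closedH: "closed_map B K H"
    using cB hK H continuous_imp_closed_map by blast
  have esub: "e ` topspace X \<subseteq> topspace K" and bsub: "b ` topspace X \<subseteq> topspace B"
    using ce cb continuous_map_image_subset_topspace by blast+
  have im: "H ` (topspace B - b ` topspace X) = topspace K - e ` topspace X"
  proof (intro equalityI subsetI)
    fix y assume "y \<in> H ` (topspace B - b ` topspace X)"
    then show "y \<in> topspace K - e ` topspace X" using rem(2) unfolding rem(1)[symmetric] by fast
  next
    fix y assume y: "y \<in> topspace K - e ` topspace X"
    then obtain p where "p \<in> topspace B" "y = H p" unfolding rem(1)[symmetric] by fast
    then show "y \<in> H ` (topspace B - b ` topspace X)" using y rem(2) by fast
  qed
  have pre: "topspace B - b ` topspace X = {p \<in> topspace B. H p \<in> topspace K - e ` topspace X}"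
    using rem(2) unfolding rem(1)[symmetric] by fast
  have "fsigma_in K (topspace K - e ` topspace X) \<longleftrightarrow> fsigma_in B (topspace B - b ` topspace X)"
  proof
    assume "fsigma_in K (topspace K - e ` topspace X)"
    then obtain C where C: "\<And>n::nat. closedin K (C n)" "\<Union>(range C) = topspace K - e ` topspace X"
      unfolding fsigma_in_ascending by blast
    have "topspace B - b ` topspace X = (\<Union>n. {p \<in> topspace B. H p \<in> C n})"
      unfolding pre C(2)[symmetric] by auto
    moreover have "fsigma_in B (\<Union>n. {p \<in> topspace B. H p \<in> C n})"
      using C(1) H by (intro fsigma_in_Union)
        (auto intro!: closed_imp_fsigma_in closedin_continuous_map_preimage)
    ultimately show "fsigma_in B (topspace B - b ` topspace X)" by simp
  next
    assume "fsigma_in B (topspace B - b ` topspace X)"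
    then obtain C where C: "\<And>n::nat. closedin B (C n)" "\<Union>(range C) = topspace B - b ` topspace X"
      unfolding fsigma_in_ascending by blast
    have "topspace K - e ` topspace X = (\<Union>n. H ` C n)"
      unfolding im[symmetric] C(2)[symmetric] by (rule image_UN)
    moreover have "fsigma_in K (\<Union>n. H ` C n)"
      using C(1) closedH by (intro fsigma_in_Union)
        (auto intro!: closed_imp_fsigma_in simp: closed_map_def)
    ultimately show "fsigma_in K (topspace K - e ` topspace X)" by simp
  qed
  then show ?thesis
    unfolding gdelta_in_fsigma_in using esub bsub by (simp only: B_def b_def)
qed

lemma Cech_complete_space_iff:
  assumes "Hausdorff_compactification X K e"
  shows "Cech_complete_space X \<longleftrightarrow> gdelta_in K (e ` topspace X)"
proof -
  have SC: "Hausdorff_compactification X (Stone_Cech X) (Stone_Cech_embedding X)"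
    using Hausdorff_compactification_imp_Tychonoff[OF assms]
    by (rule Hausdorff_compactification_Stone_Cech)
  show ?thesis
  proof
    assume "Cech_complete_space X"
    then show "gdelta_in K (e ` topspace X)"
      unfolding Cech_complete_space_def gdelta_in_Stone_Cech_iff[OF assms]
      using gdelta_in_Stone_Cech_iff by blast
  next
    assume "gdelta_in K (e ` topspace X)"
    then show "Cech_complete_space X"
      using SC unfolding Cech_complete_space_def gdelta_in_Stone_Cech_iff[OF assms] by blast
  qed
qed

end

theory Submission
  imports Defs
begin

text \<open>Write \<open>B\<close> for the Stone-Cech compactification of \<open>X\<close>, regard \<open>X\<close> as a subspace of \<open>B\<close>, and
  let \<open>C\<close> be the closure of \<open>A\<close> in \<open>B\<close>.  As \<open>A\<close> is closed in \<open>X\<close>, the set \<open>C\<close> meets \<open>X\<close> in \<open>A\<close>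
  only (\<open>closure_of_embedded_closed_set\<close>), so both conditions are about separating the
  remainder \<open>C - A\<close> from \<open>X\<close>.

  Let \<open>A\<close> be Lindelof and C-embedded.  Cech-completeness writes \<open>C - A\<close> as a countable union of
  sets \<open>F n\<close> closed in \<open>B\<close> (\<open>Cech_complete_remainder\<close>), so it is enough to cover each \<open>F n\<close> by a
  zero-set of \<open>B\<close> that misses \<open>X\<close>.  The Lindelof property yields a zero-set \<open>Z\<close> around
  \<open>F n\<close> that misses \<open>A\<close> (\<open>Lindelof_separated_by_zero_set\<close>), but \<open>Z\<close> may meet \<open>X\<close>.  C-embedding
  repairs this: if \<open>Z\<close> is the zero-set of \<open>g\<close>, then \<open>1/g\<close> is a possibly unbounded function on
  \<open>A\<close>, and an extension of it to \<open>X\<close>, cut off below at 1, has as inverse a positive function whose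
  extension to \<open>B\<close> agrees with \<open>g\<close> on \<open>C\<close>
  (\<open>C_embedded_zero_set_avoiding\<close>).

  Conversely, let \<open>Y\<close> be the complement in \<open>B\<close> of the countable union of zero-sets.  Then
  \<open>X \<subseteq> Y\<close>, and \<open>C\<close> meets \<open>Y\<close> exactly in \<open>A\<close>, so that \<open>A\<close> is closed not only in \<open>X\<close> but also in
  \<open>Y\<close>.  The space \<open>Y\<close> is Lindelof (\<open>Lindelof_space_complement_zero_sets\<close>) and regular, hence
  normal.  Therefore \<open>A\<close> is Lindelof, and Tietze's theorem extends real functions from \<open>A\<close> to
  \<open>Y\<close>, in particular to \<open>X\<close>.\<close>

section \<open>Zero-sets\<close>

lemma zero_set_in_nonneg:
  assumes "zero_set_in Y Z"
  obtains g where "continuous_map Y euclideanreal g" "\<And>y. 0 \<le> g y" "\<And>y. g y \<le> 1"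
    "Z = {y \<in> topspace Y. g y = 0}"
proof -
  obtain g where g: "continuous_map Y euclideanreal g" "Z = {y \<in> topspace Y. g y = 0}"
    using assms by (auto simp: zero_set_in_def)
  show thesis
  proof
    show "continuous_map Y euclideanreal (\<lambda>y. min 1 \<bar>g y\<bar>)"
      by (intro continuous_map_real_min continuous_map_real_abs g) auto
    show "Z = {y \<in> topspace Y. min 1 \<bar>g y\<bar> = 0}"
      unfolding g by (auto simp: min_def)
  qed auto
qed

lemma continuous_map_into_sequences:
  fixes G :: "'a \<Rightarrow> nat \<Rightarrow> real"
  assumes "\<And>n. continuous_map Y euclideanreal (\<lambda>y. G y n)"
  shows "continuous_map Y euclidean G"
  unfolding euclidean_product_topology[symmetric] continuous_map_componentwise_UNIV
  using assms by blast

text \<open>The functions \<open>g n\<close> that define the sets form one map into the space of real sequences.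
  That space is metrizable, and the distance to the zero sequence vanishes exactly
  where all \<open>g n\<close> vanish; the distance is the usual convergent
  series of truncated and weighted \<open>\<bar>g n\<bar>\<close>.\<close>

lemma zero_set_in_INT:
  fixes Z :: "nat \<Rightarrow> 'a set"
  assumes "\<And>n. zero_set_in Y (Z n)"
  shows "zero_set_in Y (\<Inter>n. Z n)"
proof -
  obtain g where g: "\<And>n. continuous_map Y euclideanreal (g n)"
      "\<And>n. Z n = {y \<in> topspace Y. g n y = 0}"
    using assms unfolding zero_set_in_def by metis
  define G where "G = (\<lambda>y n. g n y)"
  have "continuous_map Y euclidean G"
    by (rule continuous_map_into_sequences) (simp add: G_def g)
  then have "continuous_map Y euclideanreal ((\<lambda>v. dist v (\<lambda>_. 0)) \<circ> G)"
    by (rule continuous_map_compose) (auto intro!: continuous_intros)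
  moreover have "(\<Inter>n. Z n) = {y \<in> topspace Y. ((\<lambda>v. dist v (\<lambda>_. 0)) \<circ> G) y = 0}"
    by (auto simp: g G_def fun_eq_iff)
  ultimately show ?thesis
    unfolding zero_set_in_def by blast
qed

text \<open>Complete regularity separates \<open>F\<close> from each single point of \<open>S\<close> by a zero-set around \<open>F\<close>.
  The complements of these zero-sets cover \<open>S\<close>, and the intersection of the zero-sets that belong
  to a countable subcover is again a zero-set.\<close>

lemma Lindelof_separated_by_zero_set:
  assumes Y: "completely_regular_space Y" and F: "closedin Y F"
    and L: "Lindelof_space (subtopology Y S)" and S: "S \<subseteq> topspace Y" "S \<inter> F = {}"
  obtains Z where "zero_set_in Y Z" "F \<subseteq> Z" "Z \<inter> S = {}"
proof (cases "S = {}")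
  case True
  have "zero_set_in Y (topspace Y)"
    unfolding zero_set_in_def by (rule exI[of _ "\<lambda>_. 0"]) auto
  then show thesis
    using that True closedin_subset[OF F] by blast
next
  case False
  define \<U> where "\<U> = {topspace Y - Z |Z. zero_set_in Y Z \<and> F \<subseteq> Z}"
  have op: "openin Y U" if "U \<in> \<U>" for U
  proof -
    obtain Z g where "U = topspace Y - Z" "continuous_map Y euclideanreal g"
      "Z = {y \<in> topspace Y. g y \<in> {0}}"
      using \<open>U \<in> \<U>\<close> by (auto simp: \<U>_def zero_set_in_def)
    then show ?thesis
      using closedin_continuous_map_preimage[of Y euclideanreal g "{0}"] by auto
  qed
  have "S \<subseteq> \<Union>\<U>"
  proof
    fix x assume "x \<in> S"
    then have "x \<in> topspace Y - F" using S by blast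
    then obtain f where f: "continuous_map Y euclideanreal f" "f x = 1" "f ` F \<subseteq> {0}"
      using Y F completely_regular_space_gen_alt[of 1 0 Y] by (metis zero_neq_one)
    have "zero_set_in Y {y \<in> topspace Y. f y = 0}"
      using f zero_set_in_def by blast
    moreover have "F \<subseteq> {y \<in> topspace Y. f y = 0}"
      using f closedin_subset[OF F] by auto
    ultimately have "topspace Y - {y \<in> topspace Y. f y = 0} \<in> \<U>"
      by (auto simp: \<U>_def)
    then show "x \<in> \<Union>\<U>"
      using f \<open>x \<in> topspace Y - F\<close> by (rule_tac UnionI) auto
  qed
  then obtain \<V> where V: "countable \<V>" "\<V> \<subseteq> \<U>" "S \<subseteq> \<Union>\<V>"
    using L op unfolding Lindelof_space_subtopology_subset[OF S(1)] by metis
  have "\<V> \<noteq> {}" using V False by auto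
  then have rV: "range (from_nat_into \<V>) = \<V>"
    using V(1) by (rule range_from_nat_into)
  then have "\<And>n. \<exists>Z. from_nat_into \<V> n = topspace Y - Z \<and> zero_set_in Y Z \<and> F \<subseteq> Z"
    using V(2) unfolding \<U>_def by blast
  then obtain Z where Z: "\<And>n. from_nat_into \<V> n = topspace Y - Z n"
      "\<And>n. zero_set_in Y (Z n)" "\<And>n. F \<subseteq> Z n"
    by metis
  show thesis
  proof
    show "zero_set_in Y (\<Inter>n. Z n)" by (rule zero_set_in_INT[OF Z(2)])
    show "F \<subseteq> (\<Inter>n. Z n)" using Z(3) by blast
    have "S \<subseteq> (\<Union>n. topspace Y - Z n)"
      using V(3) rV Z(1) by (metis image_cong)
    then show "(\<Inter>n. Z n) \<inter> S = {}" by blast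
  qed
qed

section \<open>Complements of countable unions of zero-sets in compact spaces\<close>

lemma second_countable_euclidean:
  "second_countable (euclidean :: 'a::second_countable_topology topology)"
proof -
  obtain \<B> :: "'a set set" where \<B>: "countable \<B>" "topological_basis \<B>"
    using ex_countable_basis by blast
  then have "openin euclidean V" if "V \<in> \<B>" for V
    using that topological_basis_open by (metis open_openin)
  moreover have "\<exists>V\<in>\<B>. x \<in> V \<and> V \<subseteq> U" if "openin euclidean U" "x \<in> U" for U x
    using that \<B>(2) topological_basisE by (metis open_openin)
  ultimately show ?thesis
    unfolding second_countable_def using \<B>(1) by metis
qed

text \<open>The functions whose zero-sets form \<open>\<Z>\<close> combine to a map from \<open>K\<close> to the space of real
  sequences, which is proper because \<open>K\<close> is compact.  The complement of \<open>\<Union>\<Z>\<close> is a full preimage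
  under it, namely of the sequences without zero terms.  So it is mapped properly into a
  second countable space, and the Lindelof property pulls back along proper maps.\<close>

lemma Lindelof_space_complement_zero_sets:
  assumes K: "compact_space K"
    and \<Z>: "countable \<Z>" "\<And>Z. Z \<in> \<Z> \<Longrightarrow> zero_set_in K Z"
  shows "Lindelof_space (subtopology K (topspace K - \<Union>\<Z>))"
proof -
  \<comment> \<open>Adjoining the empty zero-set makes \<open>\<Z>\<close> nonempty, hence the range of a sequence.\<close>
  have "zero_set_in K {}"
    unfolding zero_set_in_def by (rule exI[of _ "\<lambda>_. 1"]) auto
  then have Z: "zero_set_in K (from_nat_into (insert {} \<Z>) n)" for n
    using \<Z>(2) from_nat_into[of "insert {} \<Z>" n] by (metis insert_iff insert_not_empty)
  have rZ: "range (from_nat_into (insert {} \<Z>)) = insert {} \<Z>"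
    using \<Z>(1) by (intro range_from_nat_into) auto
  obtain g where g: "\<And>n. continuous_map K euclideanreal (g n)"
      "\<And>n. from_nat_into (insert {} \<Z>) n = {y \<in> topspace K. g n y = 0}"
    using Z unfolding zero_set_in_def by metis
  define G where "G = (\<lambda>y n. g n y)"
  define P :: "(nat \<Rightarrow> real) set" where "P = {v. \<forall>n. v n \<noteq> 0}"
  have "\<Union>\<Z> = (\<Union>n. {y \<in> topspace K. g n y = 0})"
    unfolding g(2)[symmetric] rZ by simp
  then have pre: "{y \<in> topspace K. G y \<in> P} = topspace K - \<Union>\<Z>"
    by (auto simp: G_def P_def)
  have "continuous_map K euclidean G"
    by (rule continuous_map_into_sequences) (simp add: G_def g)
  then have "proper_map K euclidean G"
    using K Hausdorff_space_euclidean by (intro continuous_imp_proper_map) (auto intro: Hausdorff_imp_kc_space)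
  then have "proper_map (subtopology K (topspace K - \<Union>\<Z>)) (subtopology euclidean P) G"
    using pre by (rule proper_map_restriction)
  moreover have "Lindelof_space (subtopology euclidean P)"
    by (intro second_countable_imp_Lindelof_space second_countable_subtopology
        second_countable_euclidean)
  ultimately show ?thesis
    by (rule Lindelof_space_proper_map_preimage)
qed

section \<open>Closures in a compactification\<close>

text \<open>The image of \<open>A\<close> is relatively closed in the image of \<open>X\<close>, so its closure adds only points
  of the remainder.\<close>

lemma closure_of_embedded_closed_set:
  assumes e: "embedding_map X K e" and A: "closedin X A"
  shows "K closure_of (e ` A) \<inter> e ` topspace X = e ` A"
proof -
  have sub: "A \<subseteq> topspace X" "e ` topspace X \<subseteq> topspace K"
    using closedin_subset[OF A] embedding_imp_continuous_map[OF e]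
      continuous_map_image_subset_topspace by blast+
  have "closedin (subtopology K (e ` topspace X)) (e ` A)"
    using e A homeomorphic_map_closedness_eq unfolding embedding_map_def by blast
  then obtain T where T: "closedin K T" "e ` A = T \<inter> e ` topspace X"
    unfolding closedin_subtopology by blast
  then have "K closure_of (e ` A) \<subseteq> T"
    by (intro closure_of_minimal) auto
  moreover have "e ` A \<subseteq> K closure_of (e ` A)"
    using sub by (intro closure_of_subset) auto
  ultimately show ?thesis
    using T(2) sub(1) by blast
qed

lemma embedding_map_imp_homeomorphic_image:
  assumes e: "embedding_map X K e" and A: "A \<subseteq> topspace X"
  shows "homeomorphic_map (subtopology X A) (subtopology K (e ` A)) e"
proof -
  have "homeomorphic_map (subtopology X A) (subtopology (subtopology K (e ` topspace X)) (e ` A)) e"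
    using e A continuous_map_image_subset_topspace[OF embedding_imp_continuous_map[OF e]]
    unfolding embedding_map_def by (intro homeomorphic_map_subtopologies) auto
  then show ?thesis
    using A by (simp add: subtopology_subtopology inf.absorb2 image_mono)
qed

lemma Hausdorff_compactification_subtopology:
  assumes K: "Hausdorff_compactification X K e" and A: "A \<subseteq> topspace X"
  shows "Hausdorff_compactification (subtopology X A) (subtopology K (K closure_of (e ` A))) e"
proof -
  have e: "embedding_map X K e" and "compact_space K" "Hausdorff_space K"
    using K by (auto simp: Hausdorff_compactification_def)
  have "e ` topspace X \<subseteq> topspace K"
    using e embedding_imp_continuous_map continuous_map_image_subset_topspace by blast
  then have sub: "e ` A \<subseteq> K closure_of (e ` A)"
    using A by (intro closure_of_subset) auto
  have "embedding_map (subtopology X A) (subtopology K (K closure_of (e ` A))) e"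
    using embedding_map_imp_homeomorphic_image[OF e A] A sub
    by (simp add: embedding_map_def subtopology_subtopology inf.absorb2)
  moreover have "compact_space (subtopology K (K closure_of (e ` A)))"
    using \<open>compact_space K\<close> by (intro compact_space_subtopology closedin_compact_space) auto
  ultimately show ?thesis
    using \<open>Hausdorff_space K\<close> A sub closure_of_subset_topspace[of K "e ` A"]
    by (simp add: Hausdorff_compactification_def Hausdorff_space_subtopology
        closure_of_subtopology inf.absorb2)
qed

text \<open>The closure of \<open>A\<close> in \<open>K\<close> is a compactification of \<open>A\<close>, in which the remainder of a
  Cech-complete space is an \<open>F\<^sub>\<sigma>\<close>; sets closed in this closure are closed in \<open>K\<close>.\<close>

lemma Cech_complete_remainder:
  assumes K: "Hausdorff_compactification X K e" and A: "A \<subseteq> topspace X"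
    and C: "Cech_complete_space (subtopology X A)"
  obtains F :: "nat \<Rightarrow> 'b set" where "\<And>n. closedin K (F n)"
    "K closure_of (e ` A) - e ` A = (\<Union>n. F n)"
proof -
  define D where "D = K closure_of (e ` A)"
  have "gdelta_in (subtopology K D) (e ` A)"
    using Cech_complete_space_iff[OF Hausdorff_compactification_subtopology[OF K A]] C A
    by (simp add: D_def inf.absorb2)
  moreover have "D \<subseteq> topspace K"
    unfolding D_def by (rule closure_of_subset_topspace)
  ultimately have "fsigma_in (subtopology K D) (D - e ` A)"
    by (simp add: gdelta_in_fsigma_in inf.absorb2)
  then obtain F :: "nat \<Rightarrow> 'b set" where F: "\<And>n. closedin (subtopology K D) (F n)" "\<Union>(range F) = D - e ` A"
    unfolding fsigma_in_ascending by blast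
  have "closedin K D"
    unfolding D_def by simp
  then show thesis
    using that F by (metis D_def closedin_trans_full)
qed

section \<open>Using C-embedding\<close>

text \<open>A zero-set of the compactification that misses \<open>A\<close> can be moved off all of \<open>X\<close> without losing
  a point of its trace on the closure of \<open>A\<close>.  A function \<open>g\<close> defining \<open>Z\<close> is positive on \<open>A\<close>, but an
  extension of its restriction to \<open>A\<close> could vanish on \<open>X\<close>; extending \<open>1/g\<close> instead and inverting
  keeps it positive.\<close>

lemma C_embedded_zero_set_avoiding:
  assumes X: "completely_regular_space X" "Hausdorff_space X" and A: "C_embedded_in X A"
    and Z: "zero_set_in (Stone_Cech X) Z" "Z \<inter> Stone_Cech_embedding X ` A = {}"
  obtains W where "zero_set_in (Stone_Cech X) W"
    "Z \<inter> Stone_Cech X closure_of (Stone_Cech_embedding X ` A) \<subseteq> W"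
    "W \<inter> Stone_Cech_embedding X ` topspace X = {}"
proof -
  define B where "B = Stone_Cech X"
  define e where "e = Stone_Cech_embedding X"
  have e: "continuous_map X B e"
    using Hausdorff_compactification_Stone_Cech[OF X]
    by (auto simp: B_def e_def Hausdorff_compactification_def embedding_imp_continuous_map)
  have AX: "A \<subseteq> topspace X"
    using A by (simp add: C_embedded_in_def)
  have eB: "e x \<in> topspace B" if "x \<in> topspace X" for x
    using that e continuous_map_image_subset_topspace by blast
  obtain g where g: "continuous_map B euclideanreal g" "\<And>y. 0 \<le> g y" "\<And>y. g y \<le> 1"
      "Z = {y \<in> topspace B. g y = 0}"
    using zero_set_in_nonneg[OF Z(1)] unfolding B_def by blast
  have pos: "0 < g (e x)" if "x \<in> A" for x
    using that Z(2) g(2)[of "e x"] g(4) eB[of x] AX unfolding e_def[symmetric] by fastforce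
  have ge: "continuous_map (subtopology X A) euclideanreal (\<lambda>x. g (e x))"
    using continuous_map_compose[OF e g(1)] by (auto simp: o_def intro: continuous_map_from_subtopology)
  then have "continuous_map (subtopology X A) euclideanreal (\<lambda>x. inverse (g (e x)))"
    by (intro continuous_map_real_inverse) (auto dest!: pos)
  then obtain h where h: "continuous_map X euclideanreal h"
      "\<And>x. x \<in> A \<Longrightarrow> h x = inverse (g (e x))"
    using A unfolding C_embedded_in_def by blast
  \<comment> \<open>The cut-off at 1 puts the values of \<open>k\<close> in \<open>(0,1]\<close>; on \<open>A\<close> it changes nothing, as \<open>g \<le> 1\<close>.\<close>
  define k where "k x = inverse (max 1 (h x))" for x
  have k01: "0 < k x" "k x \<le> 1" for x
    by (auto simp: k_def inverse_le_1_iff)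
  have "continuous_map X euclideanreal k"
    unfolding k_def by (intro continuous_map_real_inverse continuous_map_real_max h) auto
  then have "continuous_map X (top_of_set {0..1}) k"
    using k01 by (auto simp: continuous_map_in_subtopology less_imp_le)
  moreover have "compact_space (top_of_set {0..1::real})" "Hausdorff_space (top_of_set {0..1::real})"
    by (auto simp: compact_space_subtopology Hausdorff_space_subtopology)
  ultimately obtain H where "continuous_map B (top_of_set {0..1}) H"
      and H: "\<And>x. x \<in> topspace X \<Longrightarrow> H (e x) = k x"
    using Stone_Cech_extension[OF X] unfolding B_def e_def by metis
  then have cH: "continuous_map B euclideanreal H"
    using continuous_map_in_subtopology by blast
  have HA: "H y = g y" if y: "y \<in> e ` A" for y
  proof -
    obtain x where x: "x \<in> A" "y = e x" using y by blast
    have "1 \<le> inverse (g (e x))"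
      using g(3)[of "e x"] pos[OF x(1)] by (simp add: one_le_inverse_iff)
    then have "k x = g (e x)"
      by (simp add: k_def h(2)[OF x(1)] max_def)
    then show ?thesis
      using H x AX by auto
  qed
  \<comment> \<open>\<open>H\<close> and \<open>g\<close> are continuous on the whole compactification, so equality passes to the closure.\<close>
  have HC: "H y = g y" if "y \<in> B closure_of (e ` A)" for y
    by (rule forall_in_closure_of_eq[OF that Hausdorff_space_euclidean cH g(1) HA])
  show thesis
  proof
    show "zero_set_in (Stone_Cech X) {y \<in> topspace B. H y = 0}"
      using cH by (auto simp: zero_set_in_def B_def)
    show "Z \<inter> Stone_Cech X closure_of (Stone_Cech_embedding X ` A) \<subseteq> {y \<in> topspace B. H y = 0}"
      using HC g(4) by (auto simp: B_def e_def)
    show "{y \<in> topspace B. H y = 0} \<inter> Stone_Cech_embedding X ` topspace X = {}"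
    proof -
      have "H (e x) \<noteq> 0" if "x \<in> topspace X" for x
        using H[OF that] k01(1)[of x] by simp
      then show ?thesis
        by (auto simp: e_def)
    qed
  qed
qed

section \<open>The characterization\<close>

theorem theorem2p4:
  fixes X :: "'a topology" and A :: "'a set"
  assumes "completely_regular_space X" and "Hausdorff_space X"
    and "closedin X A" and "Cech_complete_space (subtopology X A)"
  shows "(Lindelof_space (subtopology X A) \<and> C_embedded_in X A) \<longleftrightarrow>
    (\<exists>\<Z>. countable \<Z> \<and> (\<forall>Z\<in>\<Z>. zero_set_in (Stone_Cech X) Z) \<and>
         (Stone_Cech X closure_of (Stone_Cech_embedding X ` A)) - Stone_Cech_embedding X ` A \<subseteq> \<Union>\<Z> \<and>
         \<Union>\<Z> \<subseteq> topspace (Stone_Cech X) - Stone_Cech_embedding X ` topspace X)"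
proof -
  define B where "B = Stone_Cech X"
  define e where "e = Stone_Cech_embedding X"
  define C where "C = B closure_of (e ` A)"
  have K: "Hausdorff_compactification X B e"
    using Hausdorff_compactification_Stone_Cech assms(1,2) by (simp add: B_def e_def)
  then have B: "compact_space B" "Hausdorff_space B" and e: "embedding_map X B e"
    by (auto simp: Hausdorff_compactification_def)
  have AX: "A \<subseteq> topspace X"
    using assms(3) closedin_subset by blast
  have eX: "e ` topspace X \<subseteq> topspace B"
    using e embedding_imp_continuous_map continuous_map_image_subset_topspace by blast
  have CX: "C \<inter> e ` topspace X = e ` A"
    unfolding C_def by (rule closure_of_embedded_closed_set[OF e assms(3)])
  have reg: "completely_regular_space B"
    using B compact_Hausdorff_or_regular_imp_normal_space Hausdorff_imp_t1_space
      normal_imp_completely_regular_space by blast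
  have Lin: "Lindelof_space (subtopology X A) \<longleftrightarrow> Lindelof_space (subtopology B (e ` A))"
    using embedding_map_imp_homeomorphic_image[OF e AX] homeomorphic_imp_perfect_map
      Lindelof_space_perfect_map_image_eq by blast
  have "Lindelof_space (subtopology X A) \<and> C_embedded_in X A \<longleftrightarrow>
    (\<exists>\<Z>. countable \<Z> \<and> (\<forall>Z\<in>\<Z>. zero_set_in B Z) \<and>
         C - e ` A \<subseteq> \<Union>\<Z> \<and> \<Union>\<Z> \<subseteq> topspace B - e ` topspace X)" (is "?L \<longleftrightarrow> ?R")
  proof
    assume L: ?L
    obtain F :: "nat \<Rightarrow> _" where F: "\<And>n. closedin B (F n)" "C - e ` A = (\<Union>n. F n)"
      using Cech_complete_remainder[OF K AX assms(4)] unfolding C_def by blast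
    have "\<exists>W. zero_set_in B W \<and> F n \<subseteq> W \<and> W \<inter> e ` topspace X = {}" for n
    proof -
      have "e ` A \<subseteq> topspace B" "e ` A \<inter> F n = {}"
        using AX eX F(2) by blast+
      then obtain Z where Z: "zero_set_in B Z" "F n \<subseteq> Z" "Z \<inter> e ` A = {}"
        using Lindelof_separated_by_zero_set[OF reg F(1)] L Lin by metis
      obtain W where "zero_set_in B W" "Z \<inter> C \<subseteq> W" "W \<inter> e ` topspace X = {}"
        using C_embedded_zero_set_avoiding[OF assms(1,2)] L Z(1,3) unfolding B_def e_def C_def by metis
      then show ?thesis
        using Z(2) F(2) by blast
    qed
    then obtain W where W: "\<And>n. zero_set_in B (W n)" "\<And>n. F n \<subseteq> W n"
        "\<And>n. W n \<inter> e ` topspace X = {}"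
      by metis
    show ?R
    proof (intro exI[of _ "range W"] conjI)
      show "C - e ` A \<subseteq> \<Union>(range W)"
        unfolding F(2) using W(2) by blast
      have "W n \<subseteq> topspace B" for n
        using W(1)[of n] by (auto simp: zero_set_in_def)
      then show "\<Union>(range W) \<subseteq> topspace B - e ` topspace X"
        using W(3) by blast
    qed (use W(1) in auto)
  next
    assume ?R
    then obtain \<Z> where \<Z>: "countable \<Z>" "\<forall>Z\<in>\<Z>. zero_set_in B Z"
        "C - e ` A \<subseteq> \<Union>\<Z>" "\<Union>\<Z> \<subseteq> topspace B - e ` topspace X"
      by (elim exE conjE)
    define Y where "Y = subtopology B (topspace B - \<Union>\<Z>)"
    have LY: "Lindelof_space Y"
      unfolding Y_def by (rule Lindelof_space_complement_zero_sets[OF B(1) \<Z>(1) bspec[OF \<Z>(2)]])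
    moreover have "regular_space Y"
      unfolding Y_def using B compact_Hausdorff_imp_regular_space regular_space_subtopology by blast
    ultimately have nY: "normal_space Y"
      by (simp add: regular_Lindelof_imp_normal_space)
    have XY: "e ` topspace X \<subseteq> topspace Y"
      using eX \<Z>(4) by (auto simp: Y_def)
    have "e ` A = (topspace B - \<Union>\<Z>) \<inter> C"
      using CX \<Z>(3,4) AX eX by blast
    then have clA: "closedin Y (e ` A)"
      unfolding Y_def closedin_subtopology by (intro exI[of _ C]) (auto simp: C_def)
    have YA: "subtopology Y (e ` A) = subtopology B (e ` A)"
      using XY AX by (auto simp: Y_def subtopology_subtopology intro!: arg_cong[of _ _ "subtopology B"])
    have "Lindelof_space (subtopology X A)"
      using Lindelof_space_closedin_subtopology[OF LY clA] YA Lin by simp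
    moreover have "C_embedded_in X A"
      unfolding C_embedded_in_def
    proof (intro conjI AX allI impI)
      fix f :: "'a \<Rightarrow> real" assume f: "continuous_map (subtopology X A) euclideanreal f"
      obtain r where r: "homeomorphic_maps (subtopology X A) (subtopology B (e ` A)) e r"
        using embedding_map_imp_homeomorphic_image[OF e AX] homeomorphic_map_maps by blast
      have "continuous_map (subtopology Y (e ` A)) euclideanreal (f \<circ> r)"
        unfolding YA using r f continuous_map_compose unfolding homeomorphic_maps_def by blast
      then obtain g where g: "continuous_map Y euclideanreal g"
          "\<And>y. y \<in> e ` A \<Longrightarrow> g y = (f \<circ> r) y"
        using Tietze_extension_realinterval[OF nY clA, of UNIV "f \<circ> r"] by auto
      have "continuous_map X Y e"
        using embedding_imp_continuous_map[OF e] XY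
        by (auto simp: Y_def continuous_map_in_subtopology)
      then have "continuous_map X euclideanreal (g \<circ> e)"
        using g(1) continuous_map_compose by blast
      moreover have "(g \<circ> e) x = f x" if "x \<in> A" for x
        using that g(2)[of "e x"] r AX by (auto simp: homeomorphic_maps_def)
      ultimately show "\<exists>g. continuous_map X euclideanreal g \<and> (\<forall>x\<in>A. g x = f x)"
        by blast
    qed
    ultimately show ?L by blast
  qed
  then show ?thesis
    by (simp add: B_def e_def C_def)
qed

end
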